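(* Assume that $y$ has rank $1$ almost surely. Let $\mathcal T_r\subseteq\mathcal V$ be any set with $\mathcal T_1\subseteq\mathcal T_r$. Then $K(U(\mathcal T_r))=K(U(\mathcal V))$.
   Context: Let $m,M\in\mathbb N$, $Y=(\mathbb R^m)^{\otimes M}$ with Frobenius inner product $(\cdot,\cdot)_{\mathrm{Fro}}$, and let $\mathcal V$ be the vector space $Y$ with, for $y\in Y$, the seminorm $|v|_y:=|(v,y)_{\mathrm{Fro}}|$ and the norm $\|v\|:=\big(\int_Y|v|_y^2\,d\rho(y)\big)^{1/2}$; this is assumed to be finite for all $v$ and to be a norm. The setting is that of recovery from rank-one samples: $\rho=\rho_1\otimes\cdots\otimes\rho_M$ for probability distributions $\rho_k$ on $\mathbb R^m$, meaning that $\rho$ is the law of $y=y_1\otimes\cdots\otimes y_M$ where $y_k\sim\rho_k$ are independent. A weight function $w\ge0$ on $Y$ with $\int_Y w^{-1}\,d\rho=1$ is fixed. $\mathcal T_1:=\{v\in\mathcal V: v=v_1\otimes\cdots\otimes v_M\text{ with }v_1,\dots,v_M\in\mathbb R^m\}$. The set $\mathcal T_r$ stands for the tensors of rank at most $r$ with respect to an arbitrary notion of rank satisfying $\mathcal T_1\subseteq\mathcal T_r$ (e.g. CP, Tucker, tensor train, hierarchical Tucker). For $A\subseteq\mathcal V$: $U(A):=\{u/\|u\|:u\in A\setminus\{0\}\}$ and $K(A):=\sup_{u\in A}\operatorname{ess\,sup}_{y\in Y}w(y)|u|_y^2\in[0,\infty]$ (essential supremum with respect to $\rho$). *)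

theory Defs
  imports "HOL-Probability.Probability"
begin

text \<open>
  An element of the \<open>M\<close>-fold tensor power of \<open>\<real>\<^sup>m\<close> is represented by its entries: with the
  finite index types \<open>'k\<close> (the \<open>M\<close> tensor factors) and \<open>'m\<close> (the \<open>m\<close> coordinates of a factor),
  it is a vector whose coordinates are the multi-indices \<open>i :: 'k \<Rightarrow> 'm\<close>. The Frobenius inner
  product is then the inner product of this Euclidean space.
\<close>

type_synonym ('m, 'k) tensor = "real ^ ('k \<Rightarrow> 'm)"

definition elementary_tensor ::
    "('k::finite \<Rightarrow> real ^ 'm::finite) \<Rightarrow> ('m, 'k) tensor" where
  "elementary_tensor x = (\<chi> i. \<Prod>k\<in>UNIV. x k $ i k)"

definition T1 :: "('m::finite, 'k::finite) tensor set" where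
  "T1 = {v. \<exists>x. v = elementary_tensor x}"

text \<open>
  \<^const>\<open>T1\<close> also contains the zero tensor, which has rank 0.
\<close>

definition has_rank_one :: "('m::finite, 'k::finite) tensor \<Rightarrow> bool" where
  "has_rank_one v \<longleftrightarrow> v \<in> T1 \<and> v \<noteq> 0"

text \<open>
  The law of \<open>y\<^sub>1 \<otimes> \<dots> \<otimes> y\<^sub>M\<close> for independent \<open>y\<^sub>k\<close> with law \<open>\<rho>s k\<close>.
\<close>

definition sample_law ::
    "('k::finite \<Rightarrow> (real ^ 'm::finite) measure) \<Rightarrow> ('m, 'k) tensor measure" where
  "sample_law \<rho>s = distr (Pi\<^sub>M UNIV \<rho>s) borel elementary_tensor"

lemma measurable_elementary_tensor:
  fixes \<rho>s :: "'k::finite \<Rightarrow> (real ^ 'm::finite) measure"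
  assumes "\<And>k. sets (\<rho>s k) = sets borel"
  shows "elementary_tensor \<in> borel_measurable (Pi\<^sub>M UNIV \<rho>s)"
proof -
  have comp: "(\<lambda>x. x k) \<in> borel_measurable (Pi\<^sub>M UNIV \<rho>s)" for k
    using measurable_component_singleton[of k UNIV \<rho>s]
      measurable_cong_sets[OF refl assms[of k], of "Pi\<^sub>M UNIV \<rho>s"] by simp
  have "(\<lambda>x. x k $ j) \<in> borel_measurable (Pi\<^sub>M UNIV \<rho>s)" for k j
    by (rule measurable_compose[OF comp]) simp
  then show ?thesis
    unfolding elementary_tensor_def[abs_def]
    by (subst borel_measurable_euclidean_space)
      (auto simp: Basis_vec_def inner_axis intro!: borel_measurable_prod)
qed

definition y_seminorm :: "('a::real_inner) \<Rightarrow> 'a \<Rightarrow> real" where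
  "y_seminorm y v = \<bar>v \<bullet> y\<bar>"

definition V_norm :: "('a::real_inner) measure \<Rightarrow> 'a \<Rightarrow> real" where
  "V_norm \<rho> v = sqrt (\<integral>y. (y_seminorm y v)\<^sup>2 \<partial>\<rho>)"

definition is_norm :: "('a::real_vector \<Rightarrow> real) \<Rightarrow> bool" where
  "is_norm N \<longleftrightarrow>
     (\<forall>v. 0 \<le> N v) \<and> (\<forall>v. N v = 0 \<longleftrightarrow> v = 0) \<and>
     (\<forall>c v. N (c *\<^sub>R v) = \<bar>c\<bar> * N v) \<and> (\<forall>u v. N (u + v) \<le> N u + N v)"

definition U_normalized :: "('a::real_inner) measure \<Rightarrow> 'a set \<Rightarrow> 'a set" where
  "U_normalized \<rho> A = {(1 / V_norm \<rho> u) *\<^sub>R u | u. u \<in> A - {0}}"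

definition K_const ::
    "('a::real_inner) measure \<Rightarrow> ('a \<Rightarrow> real) \<Rightarrow> 'a set \<Rightarrow> ennreal" where
  "K_const \<rho> w A = (SUP u\<in>A. esssup \<rho> (\<lambda>y. ennreal (w y * (y_seminorm y u)\<^sup>2)))"

end

theory Submission
  imports Defs
begin

text \<open>
  Let \<open>G u = \<integral>(u, y) y d\<rho>\<close>, so that \<open>(v, G u)\<close> is the inner product inducing \<open>\<parallel>\<cdot>\<parallel>\<close>. If \<open>y = G u\<close>, then
  by Cauchy--Schwarz \<open>u\<close> maximises \<open>|v|\<^sub>y / \<parallel>v\<parallel>\<close> over all \<open>v \<noteq> 0\<close>. For a product law, \<open>G\<close> is the tensor
  product of the second moment maps \<open>G\<^sub>k\<close> of the factors, so for \<open>y = y\<^sub>1 \<otimes> \<dots> \<otimes> y\<^sub>M\<close> the maximiser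
  \<open>G\<^sub>1\<^sup>-\<^sup>1 y\<^sub>1 \<otimes> \<dots> \<otimes> G\<^sub>M\<^sup>-\<^sup>1 y\<^sub>M\<close> is itself elementary. A countable dense set of elementary tensors
  allows the supremum and the essential supremum to be exchanged.
\<close>

text \<open>The uncentred covariance operator. A general Euclidean space is allowed because it
  serves both the tensor law and each factor law.\<close>

definition second_moment :: "'a::euclidean_space measure \<Rightarrow> 'a \<Rightarrow> 'a" where
  "second_moment M u = (\<integral>y. (u \<bullet> y) *\<^sub>R y \<partial>M)"

section \<open>Second moment maps on a Euclidean space and the comparison of constants\<close>

context
  fixes M :: "'a::euclidean_space measure"
  assumes sets_M [measurable_cong]: "sets M = sets borel"
    and integrable_norm_sq: "integrable M (\<lambda>y. (norm y)\<^sup>2)"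
begin

lemma integrable_second_moment: "integrable M (\<lambda>y. (u \<bullet> y) *\<^sub>R y)"
proof (rule Bochner_Integration.integrable_bound)
  show "integrable M (\<lambda>y. norm u * (norm y)\<^sup>2)"
    using integrable_norm_sq by simp
  show "AE y in M. norm ((u \<bullet> y) *\<^sub>R y) \<le> norm (norm u * (norm y)\<^sup>2)"
    by (intro always_eventually allI)
      (simp add: power2_eq_square mult_right_mono Cauchy_Schwarz_ineq2 mult.assoc[symmetric])
qed measurable

lemma linear_second_moment: "linear (second_moment M)"
proof (rule linearI)
  fix u v :: 'a and c :: real
  show "second_moment M (u + v) = second_moment M u + second_moment M v"
    unfolding second_moment_def inner_left_distrib scaleR_left_distrib
    by (rule Bochner_Integration.integral_add) (rule integrable_second_moment)+
  show "second_moment M (c *\<^sub>R u) = c *\<^sub>R second_moment M u"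
    unfolding second_moment_def inner_scaleR_left scaleR_scaleR[symmetric]
    by (rule integral_scaleR_right)
qed

lemma inner_second_moment: "v \<bullet> second_moment M u = (\<integral>y. (v \<bullet> y) * (u \<bullet> y) \<partial>M)"
  unfolding second_moment_def
  by (subst integral_inner_right[OF integrable_second_moment, symmetric])
    (simp add: mult.commute)

lemma integrable_inner_mult: "integrable M (\<lambda>y. (v \<bullet> y) * (u \<bullet> y))"
  using integrable_inner_right[OF integrable_second_moment, of v u] by (simp add: mult.commute)

lemma V_norm_sq: "(V_norm M u)\<^sup>2 = u \<bullet> second_moment M u"
  by (simp add: V_norm_def y_seminorm_def inner_second_moment power2_eq_square)

lemma continuous_on_V_norm: "continuous_on S (V_norm M)"
proof -
  have "V_norm M = (\<lambda>u. sqrt (u \<bullet> second_moment M u))"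
    by (simp add: fun_eq_iff V_norm_def y_seminorm_def inner_second_moment power2_eq_square)
  moreover have "continuous_on S (second_moment M)"
    by (rule linear_continuous_on) (simp add: linear_second_moment linear_linear)
  ultimately show ?thesis
    by (auto intro!: continuous_intros)
qed

text \<open>Cauchy-Schwarz for a form known here only to be positive semidefinite: a quadratic in
  \<open>t\<close> that is never negative cannot have positive discriminant.\<close>

lemma inner_second_moment_sq_le:
  "(v \<bullet> second_moment M u)\<^sup>2 \<le> (V_norm M v)\<^sup>2 * (V_norm M u)\<^sup>2"
proof -
  interpret linear "second_moment M" by (rule linear_second_moment)
  let ?B = "\<lambda>v u. v \<bullet> second_moment M u"
  have sym: "?B u v = ?B v u" for u v
    by (simp add: inner_second_moment mult.commute)
  have nonneg: "0 \<le> ?B u u" for u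
    using V_norm_sq[of u] by (metis zero_le_power2)
  have expand: "0 \<le> ?B v v - 2 * t * ?B v u + t\<^sup>2 * ?B u u" for t
    using nonneg[of "v - t *\<^sub>R u"] sym[of u v]
    by (simp add: diff scale inner_diff_left inner_diff_right power2_eq_square algebra_simps)
  have "(?B v u)\<^sup>2 \<le> ?B v v * ?B u u"
  proof (cases "?B u u = 0")
    case True
    have "?B v u = 0"
    proof (rule ccontr)
      assume "?B v u \<noteq> 0"
      \<comment> \<open>For this \<open>t\<close> the quadratic, which is affine here, would take
        the value -1.\<close>
      with True expand[of "(?B v v + 1) / (2 * ?B v u)"] show False
        by (simp add: field_simps)
    qed
    with True show ?thesis by simp
  next
    case False
    with nonneg[of u] have pos: "0 < ?B u u" by simp
    \<comment> \<open>The quadratic is evaluated at its minimiser in \<open>t\<close>.\<close>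
    then show ?thesis
      using expand[of "?B v u / ?B u u"] by (simp add: field_simps power2_eq_square)
  qed
  then show ?thesis by (simp add: V_norm_sq)
qed

text \<open>If \<open>y = second_moment M u\<close> with \<open>u\<close> in \<open>A\<close>, then
  \<open>u\<close> is an extremal direction for \<open>y\<close>, so the bound at \<open>u\<close>
  controls every \<open>v\<close>.\<close>

lemma K_const_U_normalized_eq:
  assumes norm: "is_norm (V_norm M)"
    and w [measurable]: "w \<in> borel_measurable borel"
    and w_nonneg: "\<And>y. 0 \<le> w y"
    and A: "AE y in M. y \<in> second_moment M ` A"
    and AB: "A \<subseteq> B"
  shows "K_const M w (U_normalized M B) = K_const M w (U_normalized M UNIV)"
proof (rule antisym)
  show "K_const M w (U_normalized M B) \<le> K_const M w (U_normalized M UNIV)"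
    unfolding K_const_def by (rule SUP_subset_mono) (auto simp: U_normalized_def)
next
  have V_pos: "0 < V_norm M u" if "u \<noteq> 0" for u
    using norm that by (metis is_norm_def order_le_less)
  have normalized: "w y * (y_seminorm y ((1 / V_norm M u) *\<^sub>R u))\<^sup>2 = w y * (u \<bullet> y)\<^sup>2 / (V_norm M u)\<^sup>2" for u y
    by (simp add: y_seminorm_def power_divide)
  show "K_const M w (U_normalized M UNIV) \<le> K_const M w (U_normalized M B)"
  proof (cases "K_const M w (U_normalized M B)")
    case top
    then show ?thesis by simp
  next
    case (real C)
    \<comment> \<open>Multiplied out, the bound holds at \<open>u = 0\<close> too and is a closed
      condition on \<open>u\<close>.\<close>
    have AE_u: "AE y in M. w y * (u \<bullet> y)\<^sup>2 \<le> C * (V_norm M u)\<^sup>2" if "u \<in> A" for u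
    proof (cases "u = 0")
      case True
      then show ?thesis using real by simp
    next
      case False
      let ?f = "\<lambda>y. ennreal (w y * (y_seminorm y ((1 / V_norm M u) *\<^sub>R u))\<^sup>2)"
      have "esssup M ?f \<le> ennreal C"
        unfolding real(2)[symmetric] K_const_def using that False AB
        by (intro SUP_upper) (auto simp: U_normalized_def)
      moreover have "AE y in M. ?f y \<le> esssup M ?f"
        by (rule esssup_AE)
      ultimately have "AE y in M. ?f y \<le> ennreal C"
        by (auto elim: eventually_mono)
      then show ?thesis
        using V_pos[OF False] real(1)
        by (simp add: normalized w_nonneg pos_divide_le_eq)
    qed
    \<comment> \<open>The exceptional null set depends on \<open>u\<close>, while the maximiser
      depends on \<open>y\<close>. A countable dense \<open>D\<close> leaves one null set, outside
      which continuity in \<open>u\<close> gives the bound on all of \<open>A\<close>.\<close>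
    obtain D where D: "countable D" "D \<subseteq> A" "A \<subseteq> closure D"
      using separable by blast
    have "AE y in M. \<forall>u\<in>D. w y * (u \<bullet> y)\<^sup>2 \<le> C * (V_norm M u)\<^sup>2"
      using D AE_u by (subst AE_ball_countable) auto
    then have bound: "AE y in M. \<forall>v. w y * (v \<bullet> y)\<^sup>2 \<le> C * (V_norm M v)\<^sup>2"
      using A
    proof eventually_elim
      case (elim y)
      then obtain u where u: "u \<in> A" "y = second_moment M u" by auto
      have "closed {u. w y * (u \<bullet> y)\<^sup>2 \<le> C * (V_norm M u)\<^sup>2}"
        by (intro closed_Collect_le continuous_intros continuous_on_V_norm)
      then have "closure D \<subseteq> {u. w y * (u \<bullet> y)\<^sup>2 \<le> C * (V_norm M u)\<^sup>2}"
        using elim by (intro closure_minimal) auto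
      then have le_u: "w y * (u \<bullet> y)\<^sup>2 \<le> C * (V_norm M u)\<^sup>2"
        using u D by auto
      \<comment> \<open>As \<open>y = second_moment M u\<close>, the number
        \<open>u \<bullet> y\<close> is the squared norm of \<open>u\<close>, and
        \<open>le_u\<close> has one such factor to cancel.\<close>
      have le: "w y * (V_norm M u)\<^sup>2 \<le> C" if "u \<noteq> 0"
      proof (rule mult_right_le_imp_le)
        show "w y * (V_norm M u)\<^sup>2 * (V_norm M u)\<^sup>2 \<le> C * (V_norm M u)\<^sup>2"
          using le_u by (simp add: u(2) V_norm_sq[symmetric] power2_eq_square mult_ac)
      qed (use V_pos[OF that] in simp)
      show ?case
      proof (cases "u = 0")
        case True
        then have "y = 0" using u(2) linear_0[OF linear_second_moment] by simp
        then show ?thesis using real by simp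
      next
        case False
        show ?thesis
        proof
          fix v
          have "w y * (v \<bullet> y)\<^sup>2 \<le> w y * ((V_norm M v)\<^sup>2 * (V_norm M u)\<^sup>2)"
            unfolding u(2) by (intro mult_left_mono inner_second_moment_sq_le w_nonneg)
          also have "\<dots> = w y * (V_norm M u)\<^sup>2 * (V_norm M v)\<^sup>2" by simp
          also have "\<dots> \<le> C * (V_norm M v)\<^sup>2"
            by (intro mult_right_mono le False) simp
          finally show "w y * (v \<bullet> y)\<^sup>2 \<le> C * (V_norm M v)\<^sup>2" .
        qed
      qed
    qed
    show ?thesis
      unfolding K_const_def[of M w "U_normalized M UNIV"] real(2)
    proof (rule SUP_least)
      fix x assume "x \<in> U_normalized M UNIV"
      then obtain u where u: "u \<noteq> 0" "x = (1 / V_norm M u) *\<^sub>R u"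
        by (auto simp: U_normalized_def)
      \<comment> \<open>\<open>esssup\<close> is top on non-measurable functions, so the AE bound
        alone would not suffice.\<close>
      have "(\<lambda>y. ennreal (w y * (y_seminorm y x)\<^sup>2)) \<in> borel_measurable M"
        unfolding y_seminorm_def by measurable
      moreover have "AE y in M. ennreal (w y * (y_seminorm y x)\<^sup>2) \<le> ennreal C"
        using bound by eventually_elim
          (use V_pos[OF u(1)] real(1) in \<open>simp add: u(2) normalized pos_divide_le_eq\<close>)
      ultimately show "esssup M (\<lambda>y. ennreal (w y * (y_seminorm y x)\<^sup>2)) \<le> ennreal C"
        by (rule esssup_I)
    qed
  qed
qed

end

section \<open>Square integrability and elementary tensors\<close>

lemma integrable_norm_sq_of_y_seminorm:
  fixes M :: "'a::euclidean_space measure"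
  assumes "\<And>v. integrable M (\<lambda>y. (y_seminorm y v)\<^sup>2)"
  shows "integrable M (\<lambda>y. (norm y)\<^sup>2)"
proof -
  \<comment> \<open>Parseval: the seminorms of the basis vectors recover the norm of
    \<open>y\<close>.\<close>
  have "(norm y)\<^sup>2 = (\<Sum>b\<in>Basis. (y_seminorm y b)\<^sup>2)" for y :: 'a
    unfolding power2_norm_eq_inner euclidean_inner[of y y]
    by (simp add: y_seminorm_def inner_commute[of y] power2_eq_square)
  then show ?thesis using assms by simp
qed

text \<open>Expanding a product of sums picks one coordinate per factor, that is, one multi-index
  \<open>i\<close>.\<close>

lemma inner_elementary_tensor:
  "elementary_tensor u \<bullet> elementary_tensor x = (\<Prod>k\<in>UNIV. u k \<bullet> x k)"
proof -
  have "(\<Prod>k\<in>UNIV. u k \<bullet> x k) = (\<Sum>i\<in>Pi\<^sub>E UNIV (\<lambda>_. UNIV). \<Prod>k\<in>UNIV. u k $ i k * x k $ i k)"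
    unfolding inner_vec_def inner_real_def by (rule prod_sum_PiE) simp_all
  then show ?thesis
    by (simp add: elementary_tensor_def inner_vec_def prod.distrib PiE_UNIV_domain)
qed

lemma norm_elementary_tensor: "norm (elementary_tensor x) = (\<Prod>k\<in>UNIV. norm (x k))"
proof (rule power2_eq_imp_eq)
  show "(norm (elementary_tensor x))\<^sup>2 = (\<Prod>k\<in>UNIV. norm (x k))\<^sup>2"
    unfolding prod_power_distrib power2_norm_eq_inner by (rule inner_elementary_tensor)
qed (simp_all add: prod_nonneg)

section \<open>Product laws and their second moment maps\<close>

context
  fixes \<rho>s :: "'k::finite \<Rightarrow> (real ^ 'm::finite) measure"
  assumes prob_\<rho>s: "\<And>k. prob_space (\<rho>s k)"
    and sets_\<rho>s [measurable_cong]: "\<And>k. sets (\<rho>s k) = sets borel"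
begin

interpretation product_prob_space \<rho>s UNIV
  using prob_\<rho>s by (intro product_prob_spaceI)

lemma measurable_elementary_tensor' [measurable]:
  "elementary_tensor \<in> borel_measurable (Pi\<^sub>M UNIV \<rho>s)"
  by (rule measurable_elementary_tensor) (rule sets_\<rho>s)

text \<open>By Tonelli the second moment of the tensor is the product of the factor moments in
  \<open>ennreal\<close>; if it is finite and nonzero, no factor is infinite.\<close>

lemma integrable_norm_sq_factor:
  assumes int: "integrable (sample_law \<rho>s) (\<lambda>y. (norm y)\<^sup>2)"
    and nz: "AE y in sample_law \<rho>s. y \<noteq> 0"
  shows "integrable (\<rho>s k) (\<lambda>y. (norm y)\<^sup>2)"
proof -
  interpret \<rho>: prob_space "sample_law \<rho>s"
    unfolding sample_law_def by (rule prob_space_distr) measurable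
  have sets_law [measurable_cong]: "sets (sample_law \<rho>s) = sets borel"
    by (simp add: sample_law_def)
  let ?I = "\<lambda>k. \<integral>\<^sup>+x. ennreal ((norm x)\<^sup>2) \<partial>\<rho>s k"
  have "(\<integral>\<^sup>+y. ennreal ((norm y)\<^sup>2) \<partial>sample_law \<rho>s)
      = (\<integral>\<^sup>+x. (\<Prod>k\<in>UNIV. ennreal ((norm (x k))\<^sup>2)) \<partial>Pi\<^sub>M UNIV \<rho>s)"
    unfolding sample_law_def
    by (subst nn_integral_distr)
      (simp_all add: norm_elementary_tensor prod_ennreal prod_power_distrib)
  also have "\<dots> = (\<Prod>k\<in>UNIV. ?I k)"
    by (rule product_nn_integral_prod) simp_all
  finally have eq: "(\<integral>\<^sup>+y. ennreal ((norm y)\<^sup>2) \<partial>sample_law \<rho>s) = (\<Prod>k\<in>UNIV. ?I k)" .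
  \<comment> \<open>Since 0 times infinity is 0 in \<open>ennreal\<close>, a vanishing product could
    hide an infinite factor; \<open>nz\<close> excludes this.\<close>
  have "(\<integral>\<^sup>+y. ennreal ((norm y)\<^sup>2) \<partial>sample_law \<rho>s) \<noteq> 0"
  proof
    assume "(\<integral>\<^sup>+y. ennreal ((norm y)\<^sup>2) \<partial>sample_law \<rho>s) = 0"
    then have "AE y in sample_law \<rho>s. y = 0"
      by (subst (asm) nn_integral_0_iff_AE) auto
    with nz have "AE y in sample_law \<rho>s. False" by eventually_elim simp
    then show False by simp
  qed
  moreover have "(\<integral>\<^sup>+y. ennreal ((norm y)\<^sup>2) \<partial>sample_law \<rho>s) \<noteq> \<infinity>"
    using int by (simp add: integrable_iff_bounded less_top)
  ultimately have "?I k \<noteq> \<infinity>"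
    unfolding eq by (auto simp: ennreal_prod_eq_top)
  then show ?thesis
    by (simp add: integrable_iff_bounded less_top)
qed

text \<open>Each coordinate is an integral whose integrand is a product of functions of the single
  \<open>x k\<close>, so independence splits it.\<close>

lemma second_moment_elementary_tensor:
  assumes int: "integrable (sample_law \<rho>s) (\<lambda>y. (norm y)\<^sup>2)"
    and nz: "AE y in sample_law \<rho>s. y \<noteq> 0"
  shows "second_moment (sample_law \<rho>s) (elementary_tensor u)
    = elementary_tensor (\<lambda>k. second_moment (\<rho>s k) (u k))"
proof (rule vec_eq_iff[THEN iffD2], rule allI)
  fix i :: "'k \<Rightarrow> 'm"
  have sets_law: "sets (sample_law \<rho>s) = sets borel"
    by (simp add: sample_law_def)
  note factor = integrable_norm_sq_factor[OF int nz]
  have "second_moment (sample_law \<rho>s) (elementary_tensor u) $ i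
      = (\<integral>y. y $ i * (elementary_tensor u \<bullet> y) \<partial>sample_law \<rho>s)"
    using inner_second_moment[OF sets_law int, of "axis i 1" "elementary_tensor u"]
    by (simp add: inner_axis')
  \<comment> \<open>Coordinate \<open>i\<close> of \<open>elementary_tensor x\<close> is the product
    over \<open>k\<close> of the pairings of \<open>x k\<close> with
    \<open>axis (i k) 1\<close>.\<close>
  also have "\<dots> = (\<integral>x. (\<Prod>k\<in>UNIV. (axis (i k) 1 \<bullet> x k) * (u k \<bullet> x k)) \<partial>Pi\<^sub>M UNIV \<rho>s)"
    unfolding sample_law_def
    by (subst integral_distr)
      (simp_all add: inner_elementary_tensor prod.distrib inner_axis', simp add: elementary_tensor_def)
  also have "\<dots> = (\<Prod>k\<in>UNIV. \<integral>x. (axis (i k) 1 \<bullet> x) * (u k \<bullet> x) \<partial>\<rho>s k)"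
    by (rule product_integral_prod) (simp_all add: integrable_inner_mult[OF sets_\<rho>s factor])
  also have "\<dots> = elementary_tensor (\<lambda>k. second_moment (\<rho>s k) (u k)) $ i"
    by (simp add: elementary_tensor_def inner_second_moment[OF sets_\<rho>s factor, symmetric])
      (simp add: inner_axis')
  finally show "second_moment (sample_law \<rho>s) (elementary_tensor u) $ i
    = elementary_tensor (\<lambda>k. second_moment (\<rho>s k) (u k)) $ i" .
qed

text \<open>Definiteness of the norm makes each factor map injective, hence surjective in finite
  dimension; preimages are then taken slot by slot and stay elementary.\<close>

lemma T1_subset_second_moment_image:
  assumes int: "integrable (sample_law \<rho>s) (\<lambda>y. (norm y)\<^sup>2)"
    and nz: "AE y in sample_law \<rho>s. y \<noteq> 0"
    and norm: "is_norm (V_norm (sample_law \<rho>s))"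
  shows "T1 \<subseteq> second_moment (sample_law \<rho>s) ` T1"
proof -
  have sets_law: "sets (sample_law \<rho>s) = sets borel"
    by (simp add: sample_law_def)
  have surj: "surj (second_moment (\<rho>s k))" for k
  proof -
    have lin: "linear (second_moment (\<rho>s k))"
      by (rule linear_second_moment[OF sets_\<rho>s integrable_norm_sq_factor[OF int nz]])
    have "z = 0" if z: "second_moment (\<rho>s k) z = 0" for z
    proof (rule ccontr)
      assume "z \<noteq> 0"
      \<comment> \<open>A kernel vector \<open>z\<close> of one factor would make the nonzero tensor with \<open>z\<close> in that slot
        and ones elsewhere have norm zero.\<close>
      define u where "u = (\<lambda>j. if j = k then z else 1 :: real ^ 'm)"
      have "norm (elementary_tensor u) \<noteq> 0"
        using \<open>z \<noteq> 0\<close> by (auto simp: norm_elementary_tensor u_def)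
      moreover have "norm (elementary_tensor (\<lambda>j. second_moment (\<rho>s j) (u j))) = 0"
        using z by (auto simp: norm_elementary_tensor u_def intro!: exI[of _ k])
      then have "(V_norm (sample_law \<rho>s) (elementary_tensor u))\<^sup>2 = 0"
        by (simp add: V_norm_sq[OF sets_law int] second_moment_elementary_tensor[OF int nz])
      ultimately show False
        using norm by (simp add: is_norm_def)
    qed
    then have "inj (second_moment (\<rho>s k))"
      using lin by (simp add: linear_injective_0)
    with lin show ?thesis
      by (rule linear_injective_imp_surjective) simp
  qed
  show ?thesis
  proof
    fix y :: "('m, 'k) tensor" assume "y \<in> T1"
    then obtain x where x: "y = elementary_tensor x" by (auto simp: T1_def)
    have "\<exists>u. \<forall>k. x k = second_moment (\<rho>s k) (u k)"
      using surj by (intro choice allI) (auto dest: surjD)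
    then obtain u where "\<And>k. second_moment (\<rho>s k) (u k) = x k" by metis
    then have "y = second_moment (sample_law \<rho>s) (elementary_tensor u)"
      by (simp add: second_moment_elementary_tensor[OF int nz] x)
    then show "y \<in> second_moment (sample_law \<rho>s) ` T1"
      by (auto simp: T1_def)
  qed
qed

end

theorem theorem3p13:
  fixes \<rho>s :: "'k::finite \<Rightarrow> (real ^ 'm::finite) measure"
    and \<rho> :: "('m, 'k) tensor measure"
    and w :: "('m, 'k) tensor \<Rightarrow> real"
    and Tr :: "('m, 'k) tensor set"
  assumes "\<And>k. prob_space (\<rho>s k)"
    and "\<And>k. sets (\<rho>s k) = sets borel"
    and "\<rho> = sample_law \<rho>s"
    and "\<And>v. integrable \<rho> (\<lambda>y. (y_seminorm y v)\<^sup>2)"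
    and "is_norm (V_norm \<rho>)"
    and "w \<in> borel_measurable borel"
    and "\<And>y. 0 \<le> w y"
    and "(\<integral>\<^sup>+ y. inverse (ennreal (w y)) \<partial>\<rho>) = 1"
    and "AE y in \<rho>. has_rank_one y"
    and "T1 \<subseteq> Tr"
  shows "K_const \<rho> w (U_normalized \<rho> Tr) = K_const \<rho> w (U_normalized \<rho> UNIV)"
proof -
  \<comment> \<open>Rank one enters twice: nonvanishing gives finite factor moments, and lying in
    \<open>T1\<close> gives elementary preimages.\<close>
  have nz: "AE y in sample_law \<rho>s. y \<noteq> 0"
    using assms(9) unfolding assms(3) by eventually_elim (simp add: has_rank_one_def)
  have int: "integrable (sample_law \<rho>s) (\<lambda>y. (norm y)\<^sup>2)"
    using assms(4) unfolding assms(3) by (rule integrable_norm_sq_of_y_seminorm)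
  have "T1 \<subseteq> second_moment (sample_law \<rho>s) ` T1"
    using assms(1,2) int nz assms(5) unfolding assms(3) by (rule T1_subset_second_moment_image)
  moreover have "AE y in sample_law \<rho>s. y \<in> T1"
    using assms(9) unfolding assms(3) by eventually_elim (simp add: has_rank_one_def)
  ultimately have "AE y in sample_law \<rho>s. y \<in> second_moment (sample_law \<rho>s) ` T1"
    by (auto elim: eventually_mono)
  then show ?thesis
    using int assms(5-7,10) unfolding assms(3)
    by (intro K_const_U_normalized_eq) (auto simp: sample_law_def)
qed

end
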